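(* If $\mathcal{Q}(\cdot)J(\cdot)$ is normal and the inertial parameters $\Phi_1,\ldots,\Phi_N:[0,\infty)\to\mathbb{R}^{10}$ are uniformly physically consistent, then the mass matrix $M$ is uniformly bounded by a positive lower bound; specifically, then $M(q,\Theta(t))\succeq\alpha_1\mathrm{I}_n$ for all $t\ge 0$, $q\in\mathbb{R}^n$, with any positive constant $$\alpha_1<\min_{l\in\{1,\ldots,N\}}\Big\{\inf_{t\ge0}\big\{\lambda_{\min}(f(\Phi_l(t)))\big\}\Big\}\;\inf_{q\in\mathbb{R}^n}\big\{\lambda_{\min}(J(q)^\top\mathcal{Q}(q)^\top\mathcal{Q}(q)J(q))\big\},$$ where the first factor is positive due to uniform physical consistency and the second factor is positive due to normality.
   Context: Notation: $\mathrm{I}_p$ is the $p\times p$ identity, $\mathrm{sym}(p)$ the real symmetric $p\times p$ matrices, $\lambda_{\min},\lambda_{\max}$ the extremal eigenvalues of a symmetric matrix. For $x\in\mathbb{R}^3$, $\mathcal{S}(x)$ is the skew-symmetric $3\times3$ matrix with $\mathcal{S}(x)y=x\times y$ for all $y\in\mathbb{R}^3$. Kinematics: an open kinematic chain of $N$ bodies with generalized coordinates $q\in\mathbb{R}^n$. Kinematic parameters are constant (standing assumption), so the forward kinematic map $F:\mathbb{R}^n\to\mathbb{R}^{6N}$ depends only on $q$; write $F(q)=(F_{z_1}(q)^\top,F_{\phi_1}(q)^\top,\ldots,F_{z_N}(q)^\top,F_{\phi_N}(q)^\top)^\top$ with $F_{z_l},F_{\phi_l}\in\mathbb{R}^3$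 (position of the origin and rotation angles of the $l$th body-fixed frame), and $J(q)=\partial F(q)/\partial q\in\mathbb{R}^{6N\times n}$. Rotation angles $\phi\in\mathbb{R}^3$ parameterize rotation matrices $\mathcal{R}(\phi)\in\mathrm{SO}(3)$, and $E(\phi)\in\mathbb{R}^{3\times3}$ is the matrix such that along any differentiable curve $\phi(t)$ one has $\mathcal{R}(\phi)^\top\dot{\mathcal{R}}(\phi)=\mathcal{S}(E(\phi)\dot\phi)$. Set $Q(\phi)=\mathrm{diag}(\mathcal{R}(\phi)^\top,E(\phi))\in\mathbb{R}^{6\times6}$ and $\mathcal{Q}(q)=\mathrm{diag}(Q(F_{\phi_1}(q)),\ldots,Q(F_{\phi_N}(q)))\in\mathbb{R}^{6N\times6N}$. Inertial parameters: $\Phi_l\in\mathbb{R}^{10}$ has entries, in order, $m_l,h_{1,l},h_{2,l},h_{3,l},I_{11,l},I_{22,l},I_{33,l},I_{12,l},I_{23,l},I_{13,l}$; $h_l=(h_{1,l},h_{2,l},h_{3,l})^\top$, and $I_l\in\mathrm{sym}(3)$ is the symmetric matrix with entries $I_{ij,l}$. $\Theta=(\Phi_1^\top,\ldots,\Phi_N^\top)^\top\in\mathbb{R}^{10N}$. Define $$f(\Phi_l)=\begin{pmatrix}\frac12\mathrm{tr}(I_l)\mathrm{I}_3-I_l&h_l\\ h_l^\top&m_l\end{pmatrix}\in\mathrm{sym}(4),\qquad Z(\Phi_l)=\begin{pmatrix}m_l\mathrm{I}_3&-\mathcal{S}(h_l)\\ -\mathcal{S}(h_l)^\top&I_l\end{pmatrix}\in\mathrm{sym}(6),$$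 $\mathcal{Z}(\Theta)=\mathrm{diag}(Z(\Phi_1),\ldots,Z(\Phi_N))$, and the mass matrix $$M(q,\Theta)=J(q)^\top\mathcal{Q}(q)^\top\mathcal{Z}(\Theta)\mathcal{Q}(q)J(q)\in\mathrm{sym}(n).$$ Inertial parameters may depend on time $t\ge0$. Definitions: $\mathcal{Q}(\cdot)J(\cdot)$ is called normal if $\inf_{q\in\mathbb{R}^n}\{\lambda_{\min}(J(q)^\top\mathcal{Q}(q)^\top\mathcal{Q}(q)J(q))\}>0$. The inertial parameters are uniformly physically consistent if $\inf_{t\ge0}\{\lambda_{\min}(f(\Phi_l(t)))\}>0$ for all $l\in\{1,\ldots,N\}$. *)

theory Defs
  imports "HOL-Analysis.Analysis"
begin

(* real ^ 'c ^ 'r is the type of matrices with rows indexed by 'r and columns by 'c.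
   Block vectors and matrices are indexed by disjoint sums (blocks of different shape)
   or by pairs (block number, position within the block). *)

definition block_mat ::
  "real^'a^'c \<Rightarrow> real^'b^'c \<Rightarrow> real^'a^'d \<Rightarrow> real^'b^'d \<Rightarrow>
     real^('a::finite + 'b::finite)^('c::finite + 'd::finite)" where
  "block_mat A B C D = (\<chi> r c.
     case r of
       Inl i \<Rightarrow> (case c of Inl j \<Rightarrow> A $ i $ j | Inr j \<Rightarrow> B $ i $ j)
     | Inr i \<Rightarrow> (case c of Inl j \<Rightarrow> C $ i $ j | Inr j \<Rightarrow> D $ i $ j))"

definition block_diag :: "('b::finite \<Rightarrow> real^'k^'m) \<Rightarrow> real^('b \<times> 'k::finite)^('b \<times> 'm::finite)" where
  "block_diag A = (\<chi> r c. if fst r = fst c then A (fst r) $ snd r $ snd c else 0)"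

(* Only meaningful for symmetric A, where the set is finite and nonempty. *)
definition lambda_min :: "real^'n^'n \<Rightarrow> real" where
  "lambda_min A = Min {k. \<exists>v. v \<noteq> 0 \<and> A *v v = k *\<^sub>R v}"

definition psd :: "real^'n^'n \<Rightarrow> bool" where
  "psd A \<longleftrightarrow> transpose A = A \<and> (\<forall>x. 0 \<le> x \<bullet> (A *v x))"

definition loewner_ge :: "real^'n^'n \<Rightarrow> real^'n^'n \<Rightarrow> bool"  (infix "\<succeq>\<^sub>L" 50) where
  "A \<succeq>\<^sub>L B \<longleftrightarrow> psd (A - B)"

definition skew_mat :: "real^3 \<Rightarrow> real^3^3" where
  "skew_mat x = matrix (cross3 x)"

lemma skew_mat_works: "skew_mat x *v y = cross3 x y"
proof -
  have "linear (cross3 x)"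
    by (rule linearI) (simp_all add: cross_add_right cross_mult_right)
  then show ?thesis
    by (simp add: skew_mat_def)
qed

type_synonym six = "3 + 3"

(* D is the derivative of R along the curve; its existence is part of the requirement. *)
definition angular_rate_matrix :: "(real^3 \<Rightarrow> real^3^3) \<Rightarrow> (real^3 \<Rightarrow> real^3^3) \<Rightarrow> bool" where
  "angular_rate_matrix R E \<longleftrightarrow>
     (\<forall>(\<phi> :: real \<Rightarrow> real^3) v. (\<forall>t. (\<phi> has_vector_derivative v t) (at t)) \<longrightarrow>
        (\<forall>t. \<exists>D. ((\<lambda>s. R (\<phi> s)) has_vector_derivative D) (at t) \<and>
                  transpose (R (\<phi> t)) ** D = skew_mat (E (\<phi> t) *v v t)))"

(* In F q, the entries (l, Inl i) are the position of body l, the entries (l, Inr i) its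
   rotation angles. *)
definition angle_part :: "real^('b::finite \<times> six) \<Rightarrow> 'b \<Rightarrow> real^3" where
  "angle_part x l = (\<chi> i. x $ (l, Inr i))"

definition body_Q ::
  "(real^3 \<Rightarrow> real^3^3) \<Rightarrow> (real^3 \<Rightarrow> real^3^3) \<Rightarrow> real^3 \<Rightarrow> real^six^six" where
  "body_Q R E \<phi> = block_mat (transpose (R \<phi>)) 0 0 (E \<phi>)"

definition chain_Q ::
  "(real^3 \<Rightarrow> real^3^3) \<Rightarrow> (real^3 \<Rightarrow> real^3^3) \<Rightarrow> (real^'n \<Rightarrow> real^('b::finite \<times> six)) \<Rightarrow>
     real^'n \<Rightarrow> real^('b \<times> six)^('b \<times> six)" where
  "chain_Q R E F q = block_diag (\<lambda>l. body_Q R E (angle_part (F q) l))"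

definition kin_jacobian :: "(real^'n \<Rightarrow> real^('b::finite \<times> six)) \<Rightarrow> real^'n \<Rightarrow> real^'n^('b \<times> six)" where
  "kin_jacobian F q = jacobian F (at q)"

definition gram_QJ ::
  "(real^3 \<Rightarrow> real^3^3) \<Rightarrow> (real^3 \<Rightarrow> real^3^3) \<Rightarrow> (real^'n \<Rightarrow> real^('b::finite \<times> six)) \<Rightarrow>
     real^'n \<Rightarrow> real^'n^'n" where
  "gram_QJ R E F q =
     transpose (kin_jacobian F q) ** transpose (chain_Q R E F q) **
     chain_Q R E F q ** kin_jacobian F q"

(* Infima are taken in ereal, so that they are genuine infima also for sets that are
   unbounded below. *)
definition normal_QJ ::
  "(real^3 \<Rightarrow> real^3^3) \<Rightarrow> (real^3 \<Rightarrow> real^3^3) \<Rightarrow> (real^'n \<Rightarrow> real^('b::finite \<times> six)) \<Rightarrow> bool" where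
  "normal_QJ R E F \<longleftrightarrow> (INF q. ereal (lambda_min (gram_QJ R E F q))) > 0"

(* A vector Phi in R^10 lists, in this order,
     m, h_1, h_2, h_3, I_11, I_22, I_33, I_12, I_23, I_13,
   with component indices 1, ..., 10 (in the index type 10, the numeral 10 denotes 0 and
   is thus distinct from 1, ..., 9). *)

definition par_m :: "real^10 \<Rightarrow> real" where
  "par_m \<Phi> = \<Phi> $ 1"

definition par_h :: "real^10 \<Rightarrow> real^3" where
  "par_h \<Phi> = vector [\<Phi> $ 2, \<Phi> $ 3, \<Phi> $ 4]"

definition par_I :: "real^10 \<Rightarrow> real^3^3" where
  "par_I \<Phi> = vector
     [vector [\<Phi> $ 5,  \<Phi> $ 8, \<Phi> $ 10],
      vector [\<Phi> $ 8,  \<Phi> $ 6, \<Phi> $ 9],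
      vector [\<Phi> $ 10, \<Phi> $ 9, \<Phi> $ 7]]"

definition pseudo_inertia :: "real^10 \<Rightarrow> real^(3 + 1)^(3 + 1)" where
  "pseudo_inertia \<Phi> =
     block_mat ((trace (par_I \<Phi>) / 2) *\<^sub>R mat 1 - par_I \<Phi>) (columnvector (par_h \<Phi>))
               (rowvector (par_h \<Phi>))                          (mat (par_m \<Phi>))"

definition body_Z :: "real^10 \<Rightarrow> real^six^six" where
  "body_Z \<Phi> =
     block_mat (par_m \<Phi> *\<^sub>R mat 1)                (- skew_mat (par_h \<Phi>))
               (- transpose (skew_mat (par_h \<Phi>)))  (par_I \<Phi>)"

definition stack :: "('b \<Rightarrow> real^10) \<Rightarrow> real^('b::finite \<times> 10)" where
  "stack \<Phi> = (\<chi> k. \<Phi> (fst k) $ snd k)"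

definition chain_Z :: "real^('b::finite \<times> 10) \<Rightarrow> real^('b \<times> six)^('b \<times> six)" where
  "chain_Z \<Theta> = block_diag (\<lambda>l. body_Z (\<chi> i. \<Theta> $ (l, i)))"

definition mass_matrix ::
  "(real^3 \<Rightarrow> real^3^3) \<Rightarrow> (real^3 \<Rightarrow> real^3^3) \<Rightarrow> (real^'n \<Rightarrow> real^('b::finite \<times> six)) \<Rightarrow>
     real^'n \<Rightarrow> real^('b \<times> 10) \<Rightarrow> real^'n^'n" where
  "mass_matrix R E F q \<Theta> =
     transpose (kin_jacobian F q) ** transpose (chain_Q R E F q) ** chain_Z \<Theta> **
     chain_Q R E F q ** kin_jacobian F q"

definition uniformly_physically_consistent :: "('b \<Rightarrow> real \<Rightarrow> real^10) \<Rightarrow> bool" where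
  "uniformly_physically_consistent \<Phi> \<longleftrightarrow>
     (\<forall>l. (INF t\<in>{0..}. ereal (lambda_min (pseudo_inertia (\<Phi> l t)))) > 0)"

end

theory Submission
  imports Defs
begin

text \<open>
  Twice the kinetic energy of a body with twist \<open>(v, \<omega>)\<close> is the mass integral of
  \<open>\<bar>v + \<omega> \<times> x\<bar>\<^sup>2\<close>, and the \<open>i\<close>-th component of \<open>v + \<omega> \<times> x\<close> is the inner product of
  \<open>(x, 1)\<close> with \<open>a\<^sub>i = (row i of S(\<omega>), v\<^sub>i)\<close>. Hence the quadratic form of \<open>Z(\<Phi>)\<close> at
  \<open>(v, \<omega>)\<close> is the sum of the values of the form of \<open>f(\<Phi>)\<close> at \<open>a\<^sub>1, a\<^sub>2, a\<^sub>3\<close>, which is at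
  least \<open>\<lambda>\<^sub>m\<^sub>i\<^sub>n(f(\<Phi>)) (\<bar>v\<bar>\<^sup>2 + 2 \<bar>\<omega>\<bar>\<^sup>2)\<close>. Applying this bound to each block of \<open>Q J x\<close> and then
  the Rayleigh bound to the Gram matrix of \<open>Q J\<close> gives the theorem.
\<close>

section \<open>Symmetric matrices and the Rayleigh bound\<close>

lemma symmetric_inner:
  fixes A :: "real^'n^'n"
  assumes "transpose A = A"
  shows "x \<bullet> (A *v y) = y \<bullet> (A *v x)"
  by (metis assms dot_lmul_matrix inner_commute transpose_matrix_vector)

text \<open>Eigenvectors for distinct eigenvalues are orthogonal, hence independent, so there are
  only finitely many. This makes the \<open>Min\<close> in \<open>lambda_min\<close> a true lower
  bound for the eigenvalues.\<close>

lemma finite_eigenvalues_symmetric: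
  fixes A :: "real^'n^'n"
  assumes "transpose A = A"
  shows "finite {k. \<exists>v. v \<noteq> 0 \<and> A *v v = k *\<^sub>R v}" (is "finite ?S")
proof -
  define e where "e k = (SOME v. v \<noteq> 0 \<and> A *v v = k *\<^sub>R v)" for k
  have e: "e k \<noteq> 0 \<and> A *v e k = k *\<^sub>R e k" if "k \<in> ?S" for k
    unfolding e_def by (rule someI_ex) (use that in simp)
  have orth: "e j \<bullet> e k = 0" if "j \<in> ?S" "k \<in> ?S" "j \<noteq> k" for j k
  proof -
    have "e j \<bullet> (A *v e k) = e k \<bullet> (A *v e j)"
      by (rule symmetric_inner[OF assms])
    then have "k * (e j \<bullet> e k) = j * (e j \<bullet> e k)"
      using e[OF that(1)] e[OF that(2)] by (simp add: inner_commute)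
    then show ?thesis using that(3) by simp
  qed
  \<comment> \<open>An eigenvector shared by two distinct eigenvalues would be orthogonal to
    itself.\<close>
  have inj: "inj_on e ?S"
  proof (rule inj_onI)
    fix j k assume jk: "j \<in> ?S" "k \<in> ?S" "e j = e k"
    show "j = k"
      using orth[OF jk(1,2)] e[OF jk(2)] jk(3) by (metis inner_eq_zero_iff)
  qed
  have "pairwise orthogonal (e ` ?S)"
    unfolding pairwise_image pairwise_def orthogonal_def using orth by blast
  moreover have "0 \<notin> e ` ?S" using e by fastforce
  ultimately have "independent (e ` ?S)"
    by (rule pairwise_orthogonal_independent)
  then have "finite (e ` ?S)" by (rule independent_imp_finite)
  then show ?thesis using inj by (rule finite_imageD)
qed

text \<open>A zero of a nonnegative form is a minimum, so the first-order change there vanishes. In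
  the direction \<open>y = B *v u\<close> that change is twice \<open>y \<bullet> y\<close>.\<close>

lemma psd_null_vector:
  fixes B :: "real^'n^'n"
  assumes sym: "transpose B = B" and nonneg: "\<And>x. 0 \<le> x \<bullet> (B *v x)"
    and null: "u \<bullet> (B *v u) = 0"
  shows "B *v u = 0"
proof -
  define y where "y = B *v u"
  define c where "c = y \<bullet> (B *v y)"
  have ineq: "0 \<le> t * (2 * (y \<bullet> y) + t * c)" for t
  proof -
    have "(u + t *\<^sub>R y) \<bullet> (B *v (u + t *\<^sub>R y)) = t * (2 * (y \<bullet> y) + t * c)"
      using symmetric_inner[OF sym, of u y] null
      by (simp add: matrix_vector_right_distrib matrix_vector_mult_scaleR
          inner_add_left inner_add_right c_def flip: y_def) (simp add: algebra_simps)
    then show ?thesis using nonneg[of "u + t *\<^sub>R y"] by simp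
  qed
  have c: "0 \<le> c" unfolding c_def by (rule nonneg)
  have "y \<bullet> y \<le> 0"
  proof (rule ccontr)
    assume "\<not> y \<bullet> y \<le> 0"
    then have p: "0 < y \<bullet> y" by linarith
    \<comment> \<open>With this \<open>t\<close>, \<open>2 * (y \<bullet> y) + t * c\<close> equals
      \<open>y \<bullet> y - t\<close>, which is positive. The \<open>+ 1\<close> keeps the
      denominator positive when \<open>c = 0\<close>.\<close>
    define t where "t = - (y \<bullet> y) / (c + 1)"
    have t: "t < 0" using p c by (simp add: t_def divide_neg_pos)
    have "t * (c + 1) = - (y \<bullet> y)" using c by (simp add: t_def)
    then have "0 < 2 * (y \<bullet> y) + t * c" using t p unfolding distrib_left by linarith
    then have "t * (2 * (y \<bullet> y) + t * c) < 0" using t by (simp add: mult_neg_pos)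
    then show False using ineq[of t] by simp
  qed
  then show ?thesis by (metis inner_gt_zero_iff not_le y_def)
qed

text \<open>The form attains a minimum \<open>k\<close> on the unit sphere, and by homogeneity
  \<open>k\<close> bounds it everywhere. The minimizer is an eigenvector for \<open>k\<close>, so
  \<open>lambda_min A\<close> is at most \<open>k\<close>.\<close>

lemma lambda_min_le_form:
  fixes A :: "real^'n^'n"
  assumes sym: "transpose A = A"
  shows "lambda_min A * (x \<bullet> x) \<le> x \<bullet> (A *v x)"
proof -
  have "continuous_on (sphere 0 1) (\<lambda>x::real^'n. x \<bullet> (A *v x))"
    by (intro continuous_intros matrix_vector_mult_linear_continuous_on)
  moreover have "sphere (0::real^'n) 1 \<noteq> {}" by simp
  ultimately obtain u where u: "u \<in> sphere (0::real^'n) 1"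
      and umin: "\<And>y. y \<in> sphere 0 1 \<Longrightarrow> u \<bullet> (A *v u) \<le> y \<bullet> (A *v y)"
    using continuous_attains_inf[OF compact_sphere] by blast
  define k where "k = u \<bullet> (A *v u)"
  have rayleigh: "k * (y \<bullet> y) \<le> y \<bullet> (A *v y)" for y
  proof (cases "y = 0")
    case False
    define z where "z = (1 / norm y) *\<^sub>R y"
    have "z \<in> sphere 0 1" using False by (simp add: z_def)
    then have "k \<le> z \<bullet> (A *v z)" unfolding k_def by (rule umin)
    also have "\<dots> = (y \<bullet> (A *v y)) / (y \<bullet> y)"
      by (simp add: z_def matrix_vector_mult_scaleR dot_square_norm power2_eq_square)
    finally show ?thesis using False by (simp add: field_simps)
  qed simp
  \<comment> \<open>Shifting by \<open>k\<close> gives a nonnegative form that vanishes at the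
    minimizer \<open>u\<close>; its null vector \<open>u\<close> is then an eigenvector of
    \<open>A\<close>.\<close>
  define B where "B = A - k *\<^sub>R mat 1"
  have B: "B *v y = A *v y - k *\<^sub>R y" for y
    by (simp add: B_def matrix_vector_mult_diff_rdistrib flip: scaleR_matrix_vector_assoc)
  have "transpose B = B"
    using sym by (simp add: B_def vec_eq_iff transpose_def mat_def eq_commute)
  moreover have "0 \<le> y \<bullet> (B *v y)" for y
    using rayleigh[of y] by (simp add: B inner_diff_right)
  moreover have "u \<bullet> (B *v u) = 0"
    using u by (simp add: B inner_diff_right k_def dot_square_norm)
  ultimately have "B *v u = 0" by (rule psd_null_vector)
  moreover have "u \<noteq> 0" using u by auto
  ultimately have "k \<in> {k. \<exists>v. v \<noteq> 0 \<and> A *v v = k *\<^sub>R v}"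
    using B[of u] by auto
  then have "lambda_min A \<le> k"
    unfolding lambda_min_def by (intro Min_le finite_eigenvalues_symmetric sym)
  then have "lambda_min A * (x \<bullet> x) \<le> k * (x \<bullet> x)"
    by (intro mult_right_mono) auto
  then show ?thesis using rayleigh[of x] by simp
qed

section \<open>Quadratic forms of block-diagonal matrices\<close>

lemma sum_UNIV_Plus:
  "(\<Sum>k\<in>UNIV. g k) = (\<Sum>i\<in>UNIV. g (Inl i)) + (\<Sum>j\<in>UNIV. g (Inr j))"
  for g :: "'a::finite + 'b::finite \<Rightarrow> real"
  by (simp add: sum.Plus flip: UNIV_Plus_UNIV)

lemma sum_UNIV_prod: "(\<Sum>k\<in>UNIV. g k) = (\<Sum>i\<in>UNIV. \<Sum>j\<in>UNIV. g (i, j))"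
  for g :: "'a::finite \<times> 'b::finite \<Rightarrow> real"
  by (simp add: sum.cartesian_product flip: UNIV_Times_UNIV)

lemma transpose_block_diag:
  "transpose (block_diag A) = block_diag (\<lambda>l. transpose (A l))"
  by (auto simp: vec_eq_iff transpose_def block_diag_def)

lemma inner_block_diag:
  fixes A :: "'b::finite \<Rightarrow> real^'k^'k" and x :: "real^('b \<times> 'k)"
  shows "x \<bullet> (block_diag A *v x) =
    (\<Sum>l\<in>UNIV. (\<chi> i. x $ (l, i)) \<bullet> (A l *v (\<chi> i. x $ (l, i))))"
proof -
  have "(block_diag A *v x) $ (l, i) = (A l *v (\<chi> i. x $ (l, i))) $ i" for l i
  proof -
    have "(block_diag A *v x) $ (l, i) =
        (\<Sum>l'\<in>UNIV. \<Sum>j\<in>UNIV. (if l = l' then A l $ i $ j * x $ (l', j) else 0))"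
      by (auto simp: matrix_vector_mult_def block_diag_def sum_UNIV_prod intro!: sum.cong)
    \<comment> \<open>The condition does not involve \<open>j\<close>, so it leaves the inner sum,
      and the outer sum then collapses to the term \<open>l' = l\<close>.\<close>
    also have "\<dots> = (\<Sum>l'\<in>UNIV. if l = l' then (\<Sum>j\<in>UNIV. A l $ i $ j * x $ (l', j)) else 0)"
      by (intro sum.cong) auto
    finally show ?thesis by (simp add: matrix_vector_mult_def)
  qed
  then show ?thesis by (simp add: inner_vec_def sum_UNIV_prod)
qed

lemma inner_blocks:
  "x \<bullet> x = (\<Sum>l\<in>UNIV. (\<chi> i. x $ (l, i)) \<bullet> (\<chi> i. x $ (l, i)))"
  for x :: "real^('b::finite \<times> 'k::finite)"
  by (simp add: inner_vec_def sum_UNIV_prod)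

section \<open>The form of one body in terms of its pseudo-inertia\<close>

lemma transpose_par_I: "transpose (par_I \<Phi>) = par_I \<Phi>"
  by (simp add: vec_eq_iff transpose_def forall_3 par_I_def)

lemma transpose_pseudo_inertia: "transpose (pseudo_inertia \<Phi>) = pseudo_inertia \<Phi>"
proof -
  have "par_I \<Phi> $ i $ j = par_I \<Phi> $ j $ i" for i j
    using transpose_par_I[of \<Phi>] by (metis (no_types, lifting) transpose_def vec_lambda_beta)
  then show ?thesis
    by (auto simp: vec_eq_iff transpose_def pseudo_inertia_def block_mat_def mat_def
        columnvector_def rowvector_def split: sum.split)
qed

lemma transpose_body_Z: "transpose (body_Z \<Phi>) = body_Z \<Phi>"
proof -
  have "par_I \<Phi> $ i $ j = par_I \<Phi> $ j $ i" for i j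
    using transpose_par_I[of \<Phi>] by (metis (no_types, lifting) transpose_def vec_lambda_beta)
  then show ?thesis
    by (auto simp: vec_eq_iff transpose_def body_Z_def block_mat_def mat_def
        split: sum.split)
qed

text \<open>The coefficients of component \<open>i\<close> of the velocity field v + omega x p, read
  as a linear function of (p, 1).\<close>

definition field_row :: "real^six \<Rightarrow> 3 \<Rightarrow> real^(3 + 1)" where
  "field_row w i = (\<chi> k. case k of
     Inl j \<Rightarrow> skew_mat (\<chi> j. w $ Inr j) $ i $ j | Inr _ \<Rightarrow> w $ Inl i)"

lemma skew_mat_nth:
  "skew_mat x $ 1 $ 1 = 0" "skew_mat x $ 1 $ 2 = - x $ 3" "skew_mat x $ 1 $ 3 = x $ 2"
  "skew_mat x $ 2 $ 1 = x $ 3" "skew_mat x $ 2 $ 2 = 0" "skew_mat x $ 2 $ 3 = - x $ 1"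
  "skew_mat x $ 3 $ 1 = - x $ 2" "skew_mat x $ 3 $ 2 = x $ 1" "skew_mat x $ 3 $ 3 = 0"
  by (simp_all add: skew_mat_def matrix_def cross3_def axis_def)

text \<open>Let P = tr(I)/2 - I, so tr(P) = tr(I)/2. The rows s_i of S(omega) satisfy sum_i s_i^T P
  s_i = |omega|^2 tr(P) - omega^T P omega = omega^T I omega. The mixed terms agree because -S(h)
  omega = omega x h. The proof checks this in coordinates.\<close>

lemma body_Z_form:
  "w \<bullet> (body_Z \<Phi> *v w) =
    (\<Sum>i\<in>UNIV. field_row w i \<bullet> (pseudo_inertia \<Phi> *v field_row w i))"
proof -
  define H where "H = par_h \<Phi>"
  define K where "K = par_I \<Phi>"
  define \<mu> where "\<mu> = par_m \<Phi>"
  define v where "v = (\<lambda>i. w $ Inl i)"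
  define \<omega> where "\<omega> = (\<chi> j. w $ Inr j)"
  have K_sym: "K $ 2 $ 1 = K $ 1 $ 2" "K $ 3 $ 1 = K $ 1 $ 3" "K $ 3 $ 2 = K $ 2 $ 3"
    by (simp_all add: K_def par_I_def)
  have Z: "w \<bullet> (body_Z \<Phi> *v w) =
      \<mu> * (\<Sum>i\<in>UNIV. v i * v i) + 2 * (\<Sum>i\<in>UNIV. v i * (\<Sum>j\<in>UNIV. - skew_mat H $ i $ j * \<omega> $ j))
      + (\<Sum>i\<in>UNIV. \<Sum>j\<in>UNIV. K $ i $ j * \<omega> $ i * \<omega> $ j)"
    by (simp add: inner_vec_def matrix_vector_mult_def sum_UNIV_Plus sum_3 body_Z_def
        block_mat_def mat_def skew_mat_nth transpose_def flip: H_def K_def \<mu>_def)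
      (simp add: v_def \<omega>_def algebra_simps)
  have f: "field_row w i \<bullet> (pseudo_inertia \<Phi> *v field_row w i) =
      trace K / 2 * (\<Sum>j\<in>UNIV. skew_mat \<omega> $ i $ j * skew_mat \<omega> $ i $ j)
      - (\<Sum>j\<in>UNIV. \<Sum>k\<in>UNIV. K $ j $ k * skew_mat \<omega> $ i $ j * skew_mat \<omega> $ i $ k)
      + 2 * v i * (\<Sum>j\<in>UNIV. H $ j * skew_mat \<omega> $ i $ j) + \<mu> * v i * v i" for i
    by (simp add: inner_vec_def matrix_vector_mult_def sum_UNIV_Plus sum_3 UNIV_1
        pseudo_inertia_def block_mat_def mat_def columnvector_def rowvector_def
        field_row_def flip: H_def K_def \<mu>_def \<omega>_def)
      (simp add: v_def algebra_simps)
  show ?thesis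
    by (simp add: Z f sum_3 skew_mat_nth trace_def K_sym add_divide_distrib algebra_simps)
qed

text \<open>Each component of omega occurs twice, up to sign, in S(omega). One copy completes
  \<open>w \<bullet> w\<close>; the other is the extra sum.\<close>

lemma field_row_norms:
  "(\<Sum>i\<in>UNIV. field_row w i \<bullet> field_row w i) =
    w \<bullet> w + (\<Sum>j\<in>UNIV. (w $ Inr j)\<^sup>2)"
  by (simp add: inner_vec_def sum_UNIV_Plus sum_3 field_row_def skew_mat_nth UNIV_1
      power2_eq_square)

lemma body_Z_form_ge:
  assumes "0 \<le> c" and "c \<le> lambda_min (pseudo_inertia \<Phi>)"
  shows "c * (w \<bullet> w) \<le> w \<bullet> (body_Z \<Phi> *v w)"
proof -
  \<comment> \<open>The surplus |omega|^2 is discarded, which \<open>0 \<le> c\<close>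
    permits.\<close>
  have "c * (w \<bullet> w) \<le> c * (\<Sum>i\<in>UNIV. field_row w i \<bullet> field_row w i)"
    unfolding field_row_norms using assms(1) by (intro mult_left_mono) (auto intro: sum_nonneg)
  also have "\<dots> = (\<Sum>i\<in>UNIV. c * (field_row w i \<bullet> field_row w i))"
    by (rule sum_distrib_left)
  also have "\<dots> \<le> (\<Sum>i\<in>UNIV. field_row w i \<bullet> (pseudo_inertia \<Phi> *v field_row w i))"
  proof (rule sum_mono)
    fix i
    have "c * (field_row w i \<bullet> field_row w i)
        \<le> lambda_min (pseudo_inertia \<Phi>) * (field_row w i \<bullet> field_row w i)"
      using assms(2) by (intro mult_right_mono) auto
    also have "\<dots> \<le> field_row w i \<bullet> (pseudo_inertia \<Phi> *v field_row w i)"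
      by (rule lambda_min_le_form[OF transpose_pseudo_inertia])
    finally show "c * (field_row w i \<bullet> field_row w i)
      \<le> field_row w i \<bullet> (pseudo_inertia \<Phi> *v field_row w i)" .
  qed
  finally show ?thesis by (simp only: body_Z_form)
qed

section \<open>From single bodies to the mass matrix of the chain\<close>

lemma chain_Z_stack: "chain_Z (stack \<Phi>) = block_diag (\<lambda>l. body_Z (\<Phi> l))"
  by (simp add: chain_Z_def stack_def)

lemma chain_Z_form_ge:
  assumes "0 \<le> c" and "\<And>l. c \<le> lambda_min (pseudo_inertia (\<Phi> l))"
  shows "c * (w \<bullet> w) \<le> w \<bullet> (chain_Z (stack \<Phi>) *v w)"
  unfolding chain_Z_stack inner_block_diag inner_blocks[of w] sum_distrib_left
  by (intro sum_mono body_Z_form_ge assms)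

lemma inner_congruence:
  fixes P :: "real^'n^'m"
  shows "x \<bullet> ((transpose P ** W ** P) *v x) = (P *v x) \<bullet> (W *v (P *v x))"
  by (metis dot_lmul_matrix inner_commute matrix_vector_mul_assoc transpose_matrix_vector
      transpose_transpose)

text \<open>The factor \<open>mat 1\<close> brings the Gram matrix into the same congruence shape as
  the mass matrix, so that \<open>inner_congruence\<close> serves both.\<close>

lemma gram_QJ_eq:
  "gram_QJ R E F q = transpose (chain_Q R E F q ** kin_jacobian F q) ** mat 1 **
    (chain_Q R E F q ** kin_jacobian F q)"
  by (simp add: gram_QJ_def matrix_transpose_mul matrix_mul_assoc)

lemma mass_matrix_eq:
  "mass_matrix R E F q \<Theta> = transpose (chain_Q R E F q ** kin_jacobian F q) ** chain_Z \<Theta> **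
    (chain_Q R E F q ** kin_jacobian F q)"
  by (simp add: mass_matrix_def matrix_transpose_mul matrix_mul_assoc)

lemma transpose_gram_QJ: "transpose (gram_QJ R E F q) = gram_QJ R E F q"
  by (simp add: gram_QJ_eq matrix_transpose_mul matrix_mul_assoc)

lemma transpose_mass_matrix:
  "transpose (mass_matrix R E F q (stack \<Phi>)) = mass_matrix R E F q (stack \<Phi>)"
  by (simp add: mass_matrix_eq matrix_transpose_mul matrix_mul_assoc chain_Z_stack
      transpose_block_diag transpose_body_Z)

lemma mass_matrix_ge:
  assumes c: "0 \<le> c" "\<And>l. c \<le> lambda_min (pseudo_inertia (\<Phi> l))"
    and a: "a \<le> c * lambda_min (gram_QJ R E F q)"
  shows "mass_matrix R E F q (stack \<Phi>) \<succeq>\<^sub>L a *\<^sub>R mat 1"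
  unfolding loewner_ge_def psd_def
proof (intro conjI allI)
  show "transpose (mass_matrix R E F q (stack \<Phi>) - a *\<^sub>R mat 1) =
      mass_matrix R E F q (stack \<Phi>) - a *\<^sub>R mat 1"
    using transpose_mass_matrix[of R E F q \<Phi>]
    by (simp add: vec_eq_iff transpose_def mat_def eq_commute)
  fix x
  define w where "w = (chain_Q R E F q ** kin_jacobian F q) *v x"
  have "a * (x \<bullet> x) \<le> c * (lambda_min (gram_QJ R E F q) * (x \<bullet> x))"
    using mult_right_mono[OF a, of "x \<bullet> x"] by (simp add: mult.assoc)
  also have "\<dots> \<le> c * (x \<bullet> (gram_QJ R E F q *v x))"
    by (intro mult_left_mono lambda_min_le_form transpose_gram_QJ c)
  also have "x \<bullet> (gram_QJ R E F q *v x) = w \<bullet> w"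
    unfolding gram_QJ_eq inner_congruence w_def by simp
  also have "c * (w \<bullet> w) \<le> w \<bullet> (chain_Z (stack \<Phi>) *v w)"
    by (rule chain_Z_form_ge[OF c])
  also have "\<dots> = x \<bullet> (mass_matrix R E F q (stack \<Phi>) *v x)"
    unfolding mass_matrix_eq inner_congruence w_def ..
  finally show "0 \<le> x \<bullet> ((mass_matrix R E F q (stack \<Phi>) - a *\<^sub>R mat 1) *v x)"
    by (simp add: matrix_vector_mult_diff_rdistrib inner_diff_right
        flip: scaleR_matrix_vector_assoc)
qed

theorem theorem2:
  fixes R E :: "real^3 \<Rightarrow> real^3^3"
    and F :: "real^'n \<Rightarrow> real^('b::finite \<times> six)"
    and \<Phi> :: "'b \<Rightarrow> real \<Rightarrow> real^10"
  assumes "\<And>\<phi>. rotation_matrix (R \<phi>)"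
    and "angular_rate_matrix R E"
    and "\<And>q. F differentiable (at q)"
    and "normal_QJ R E F"
    and "uniformly_physically_consistent \<Phi>"
  shows "(MIN l. INF t\<in>{0..}. ereal (lambda_min (pseudo_inertia (\<Phi> l t)))) > 0
    \<and> (INF q. ereal (lambda_min (gram_QJ R E F q))) > 0
    \<and> (\<exists>\<alpha>>0. \<forall>t\<ge>0. \<forall>q. mass_matrix R E F q (stack (\<lambda>l. \<Phi> l t)) \<succeq>\<^sub>L \<alpha> *\<^sub>R mat 1)
    \<and> (\<forall>\<alpha>\<^sub>1>0.
          ereal \<alpha>\<^sub>1 < (MIN l. INF t\<in>{0..}. ereal (lambda_min (pseudo_inertia (\<Phi> l t))))
                     * (INF q. ereal (lambda_min (gram_QJ R E F q))) \<longrightarrow>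
          (\<forall>t\<ge>0. \<forall>q. mass_matrix R E F q (stack (\<lambda>l. \<Phi> l t)) \<succeq>\<^sub>L \<alpha>\<^sub>1 *\<^sub>R mat 1))"
proof -
  define f where "f l = (INF t\<in>{0..}. ereal (lambda_min (pseudo_inertia (\<Phi> l t))))" for l
  define m where "m = (MIN l. f l)"
  define g where "g = (INF q. ereal (lambda_min (gram_QJ R E F q)))"
  have m: "0 < m"
    using assms(5) by (simp add: m_def f_def uniformly_physically_consistent_def)
  have g: "0 < g"
    using assms(4) by (simp add: g_def normal_QJ_def)
  have bound: "mass_matrix R E F q (stack (\<lambda>l. \<Phi> l t)) \<succeq>\<^sub>L a *\<^sub>R mat 1"
    if a: "ereal a < m * g" and t: "0 \<le> t" for a t q
  proof -
    have m_le: "m \<le> ereal (lambda_min (pseudo_inertia (\<Phi> l t)))" for l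
    proof -
      have "m \<le> f l" unfolding m_def by (rule Min_le) auto
      also have "\<dots> \<le> ereal (lambda_min (pseudo_inertia (\<Phi> l t)))"
        unfolding f_def using t by (intro INF_lower) auto
      finally show ?thesis .
    qed
    \<comment> \<open>\<open>m\<close> is positive and lies below a real eigenvalue, so it is
      finite.\<close>
    then obtain c where c: "m = ereal c"
      using m by (cases m) auto
    have "g \<le> ereal (lambda_min (gram_QJ R E F q))"
      unfolding g_def by (rule INF_lower) simp
    then have "m * g \<le> m * ereal (lambda_min (gram_QJ R E F q))"
      using m by (intro ereal_mult_left_mono) auto
    then have "ereal a \<le> ereal (c * lambda_min (gram_QJ R E F q))"
      using a c by (metis less_imp_le order_trans times_ereal.simps(1))
    then show ?thesis
      using m m_le by (intro mass_matrix_ge[of c]) (auto simp: c)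
  qed
  \<comment> \<open>The bound requires a real constant strictly below \<open>m * g\<close>; density
    of the extended reals supplies a positive one.\<close>
  obtain a where "0 < ereal a" "ereal a < m * g"
    using ereal_dense2[of 0 "m * g"] m g by (auto simp: ereal_zero_less_0_iff)
  then have "\<exists>\<alpha>>0. \<forall>t\<ge>0. \<forall>q. mass_matrix R E F q (stack (\<lambda>l. \<Phi> l t)) \<succeq>\<^sub>L \<alpha> *\<^sub>R mat 1"
    using bound by (intro exI[of _ a]) auto
  then show ?thesis
    using m g bound unfolding m_def f_def g_def by blast
qed

end
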